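(* Let $\mathcal X=\{x_1,\dots,x_n\}\subset\mathbb R$ with $x_1<x_2<\cdots<x_n$, and let $(\underline F,\overline F)$ be a $p$-box on $\mathcal X$ with credal set $\mathcal M(\underline F,\overline F)$. Then every extreme point $F$ of the convex set $\mathcal M(\underline F,\overline F)$ satisfies, for every $i=1,\dots,n$, $$F(x_i)\in\{\underline F(x_j)\colon j\ge i\}\cup\{\overline F(x_k)\colon k\le i\},$$ where the indices $j,k$ range over $\{1,\dots,n\}$.
   Context: A distribution function on $\mathcal X=\{x_1<\cdots<x_n\}$ is a non-decreasing function $F\colon\mathcal X\to[0,1]$ with $F(x_n)=1$. A $p$-box on $\mathcal X$ is a pair $(\underline F,\overline F)$ of distribution functions on $\mathcal X$ with $\underline F\le\overline F$ pointwise (so $\underline F(x_n)=\overline F(x_n)=1$). Its credal set is $\mathcal M(\underline F,\overline F)=\{F\colon F\text{ is a distribution function on }\mathcal X,\ \underline F\le F\le\overline F\}$, a bounded convex polyhedron when functions on $\mathcal X$ are identified with vectors in $\mathbb R^n$; extreme points are taken in the usual sense of convex geometry. *)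

theory Defs
  imports "HOL-Analysis.Analysis"
begin

text \<open>
  Functions on a finite set \<open>X\<close> of reals are represented by total functions on the reals whose
  values outside \<open>X\<close> are unconstrained; every notion below depends on the values on \<open>X\<close> only.
\<close>

definition distribution_function_on :: "real set \<Rightarrow> (real \<Rightarrow> real) \<Rightarrow> bool" where
  "distribution_function_on X F \<longleftrightarrow>
     mono_on X F \<and> F \<in> X \<rightarrow> {0..1} \<and> F (Max X) = 1"

definition p_box_on :: "real set \<Rightarrow> (real \<Rightarrow> real) \<Rightarrow> (real \<Rightarrow> real) \<Rightarrow> bool" where
  "p_box_on X F_low F_up \<longleftrightarrow>
     distribution_function_on X F_low \<and> distribution_function_on X F_up \<and>
     (\<forall>t\<in>X. F_low t \<le> F_up t)"

definition credal_set_on :: "real set \<Rightarrow> (real \<Rightarrow> real) \<Rightarrow> (real \<Rightarrow> real) \<Rightarrow> (real \<Rightarrow> real) set" where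
  "credal_set_on X F_low F_up =
     {F. distribution_function_on X F \<and> (\<forall>t\<in>X. F_low t \<le> F t \<and> F t \<le> F_up t)}"

text \<open>
  The identification of functions on \<open>{x\<^sub>1 < \<dots> < x\<^sub>n}\<close> with vectors in Euclidean \<open>n\<close>-space. The index
  set \<open>{1, \<dots>, n}\<close> is an arbitrary finite linearly ordered type \<open>'n\<close>, so that \<open>n = CARD('n)\<close>.
\<close>

definition vector_of_values :: "('n::finite \<Rightarrow> real) \<Rightarrow> (real \<Rightarrow> real) \<Rightarrow> real ^ 'n" where
  "vector_of_values x F = (\<chi> i. F (x i))"

end

theory Submission
  imports Defs
begin

text \<open>
  If the value \<open>c = F (x i)\<close> avoids the listed values, then by monotonicity of the bounds
  every point of the level set of \<open>c\<close> has its lower bound strictly below \<open>c\<close> and its upper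
  bound strictly above \<open>c\<close>. The whole level set can then be moved up and down by a small
  amount without leaving the credal set, so \<open>F\<close> is the midpoint of two other members.
\<close>

text \<open>When \<open>F\<close> is monotone on \<open>X\<close>, its level set in \<open>X\<close>
  is a block of consecutive points. Testing \<open>F t = c\<close> moves the block as a whole
  without naming its ends; moving a single point of it could break monotonicity.\<close>

definition shift_level :: "('a \<Rightarrow> real) \<Rightarrow> real \<Rightarrow> real \<Rightarrow> 'a \<Rightarrow> real" where
  "shift_level F c d = (\<lambda>t. if F t = c then c + d else F t)"

text \<open>The level moves by no more than its distance to any other value of \<open>F\<close> on
  \<open>X\<close>, so it may merge with another level but never crosses one, and the order
  survives. The range \<open>{0..1}\<close> is inherited from the two bounds.\<close>

lemma shift_level_in_credal_set_on:
  assumes p_box: "p_box_on X F_low F_up"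
    and F: "F \<in> credal_set_on X F_low F_up"
    and Max: "F (Max X) \<noteq> c"
    and level: "\<And>t. t \<in> X \<Longrightarrow> F t = c \<Longrightarrow> F_low t \<le> c + d \<and> c + d \<le> F_up t"
    and gap: "\<And>t. t \<in> X \<Longrightarrow> F t \<noteq> c \<Longrightarrow> \<bar>d\<bar> \<le> \<bar>F t - c\<bar>"
  shows "shift_level F c d \<in> credal_set_on X F_low F_up"
proof -
  let ?G = "shift_level F c d"
  have mono: "mono_on X F" and one: "F (Max X) = 1"
    using F by (auto simp: credal_set_on_def distribution_function_on_def)
  have bounds: "F_low t \<le> ?G t \<and> ?G t \<le> F_up t" if "t \<in> X" for t
    using F level that by (auto simp: shift_level_def credal_set_on_def)
  have "mono_on X ?G"
  proof (rule mono_onI)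
    fix s t assume st: "s \<in> X" "t \<in> X" "s \<le> t"
    then have "F s \<le> F t"
      using mono by (auto simp: mono_on_def)
    then show "?G s \<le> ?G t"
      using gap[OF st(1)] gap[OF st(2)] by (auto simp: shift_level_def)
  qed
  moreover have "?G \<in> X \<rightarrow> {0..1}"
  proof
    fix t assume t: "t \<in> X"
    then have "0 \<le> F_low t" "F_up t \<le> 1"
      using p_box by (auto simp: p_box_on_def distribution_function_on_def Pi_iff)
    then show "?G t \<in> {0..1}"
      using bounds[OF t] by auto
  qed
  moreover have "?G (Max X) = 1"
    using Max one by (simp add: shift_level_def)
  ultimately show ?thesis
    using bounds by (simp add: credal_set_on_def distribution_function_on_def)
qed

text \<open>Each point allows a positive slack \<open>r t\<close>: on the level, the room to the
  nearer bound; off it, the distance to \<open>c\<close>. Finitely many slacks have a positive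
  minimum.\<close>

lemma shift_level_radius:
  fixes F F_low F_up :: "'a \<Rightarrow> real" and c :: real
  assumes "finite X"
    and "\<And>t. t \<in> X \<Longrightarrow> F t = c \<Longrightarrow> F_low t < c \<and> c < F_up t"
  obtains e where "e > 0"
    "\<And>t d. t \<in> X \<Longrightarrow> \<bar>d\<bar> \<le> e \<Longrightarrow> F t = c \<Longrightarrow> F_low t \<le> c + d \<and> c + d \<le> F_up t"
    "\<And>t d. t \<in> X \<Longrightarrow> \<bar>d\<bar> \<le> e \<Longrightarrow> F t \<noteq> c \<Longrightarrow> \<bar>d\<bar> \<le> \<bar>F t - c\<bar>"
proof -
  define r where "r t = (if F t = c then min (F_up t - c) (c - F_low t) else \<bar>F t - c\<bar>)" for t
  \<comment> \<open>The extra element 1 keeps the minimum meaningful when \<open>X\<close> is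
    empty.\<close>
  define e where "e = Min (insert 1 (r ` X))"
  have "e > 0"
    using assms by (auto simp: e_def r_def)
  moreover have e_le: "e \<le> r t" if "t \<in> X" for t
    using assms(1) that by (simp add: e_def)
  have "F_low t \<le> c + d \<and> c + d \<le> F_up t" if "t \<in> X" "\<bar>d\<bar> \<le> e" "F t = c" for t d
    using e_le[OF that(1)] that by (auto simp: r_def)
  moreover have "\<bar>d\<bar> \<le> \<bar>F t - c\<bar>" if "t \<in> X" "\<bar>d\<bar> \<le> e" "F t \<noteq> c" for t d
    using e_le[OF that(1)] that by (auto simp: r_def)
  ultimately show thesis
    using that by blast
qed

theorem theorem1:
  fixes x :: "'n::{finite, linorder} \<Rightarrow> real"
    and F_low F_up F :: "real \<Rightarrow> real"
  assumes "strict_mono x"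
    and "p_box_on (range x) F_low F_up"
    and "F \<in> credal_set_on (range x) F_low F_up"
    and "vector_of_values x F extreme_point_of
           (vector_of_values x ` credal_set_on (range x) F_low F_up)"
  shows "\<forall>i. F (x i) \<in> {F_low (x j) |j. j \<ge> i} \<union> {F_up (x k) |k. k \<le> i}"
proof (intro allI, rule ccontr)
  fix i
  define c where "c = F (x i)"
  assume "F (x i) \<notin> {F_low (x j) |j. j \<ge> i} \<union> {F_up (x k) |k. k \<le> i}"
  then have low_ne: "\<And>j. j \<ge> i \<Longrightarrow> F_low (x j) \<noteq> c"
    and up_ne: "\<And>k. k \<le> i \<Longrightarrow> F_up (x k) \<noteq> c"
    unfolding c_def by (blast dest: sym)+
  have low_mono: "F_low (x j) \<le> F_low (x k)" and up_mono: "F_up (x j) \<le> F_up (x k)"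
    if "j \<le> k" for j k
    using assms(1,2) that
    by (auto simp: p_box_on_def distribution_function_on_def strict_mono_less_eq intro: mono_onD)
  have F_between: "F_low (x j) \<le> F (x j)" "F (x j) \<le> F_up (x j)" for j
    using assms(3) by (auto simp: credal_set_on_def)
  have strict: "F_low t < c \<and> c < F_up t" if t: "t \<in> range x" "F t = c" for t
  proof -
    obtain j where j: "t = x j"
      using t(1) by auto
    show ?thesis
    \<comment> \<open>On either side of \<open>i\<close>, one strict inequality comes from the value
      excluded at \<open>j\<close> itself, the other from the value excluded at \<open>i\<close>,
      carried over to \<open>j\<close> by monotonicity of that bound.\<close>
    proof (cases j i rule: le_cases)
      case le
      then show ?thesis
        using low_mono[of j i] low_ne[of i] F_between[of i] up_ne[of j] F_between[of j] t(2)
        by (auto simp: c_def j)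
    next
      case ge
      then show ?thesis
        using up_mono[of i j] up_ne[of i] F_between[of i] low_ne[of j] F_between[of j] t(2)
        by (auto simp: c_def j)
    qed
  qed
  \<comment> \<open>At the top point \<open>F_low\<close> and \<open>F\<close> are both 1, which
    leaves no strict gap.\<close>
  have Max: "F (Max (range x)) \<noteq> c"
  proof
    assume "F (Max (range x)) = c"
    moreover have "Max (range x) \<in> range x"
      by (rule Max_in) auto
    ultimately have "F_low (Max (range x)) < F (Max (range x))"
      using strict by auto
    then show False
      using assms(2,3)
      by (auto simp: p_box_on_def credal_set_on_def distribution_function_on_def)
  qed
  obtain e where e: "e > 0"
    and level: "\<And>t d. t \<in> range x \<Longrightarrow> \<bar>d\<bar> \<le> e \<Longrightarrow> F t = c \<Longrightarrow>
                  F_low t \<le> c + d \<and> c + d \<le> F_up t"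
    and gap: "\<And>t d. t \<in> range x \<Longrightarrow> \<bar>d\<bar> \<le> e \<Longrightarrow> F t \<noteq> c \<Longrightarrow> \<bar>d\<bar> \<le> \<bar>F t - c\<bar>"
    by (rule shift_level_radius[of "range x" F c F_low F_up]) (use strict in auto)
  let ?v = "\<lambda>d. vector_of_values x (shift_level F c d)"
  have mem: "?v d \<in> vector_of_values x ` credal_set_on (range x) F_low F_up" if "\<bar>d\<bar> \<le> e" for d
    using shift_level_in_credal_set_on[OF assms(2,3) Max] level gap that by blast
  have "?v (- e) $ i \<noteq> ?v e $ i"
    using e by (simp add: vector_of_values_def shift_level_def c_def)
  then have "?v (- e) \<noteq> ?v e"
    by auto
  \<comment> \<open>On the level, \<open>c - e\<close> and \<open>c + e\<close> average to
    \<open>c\<close>; elsewhere both shifts agree with \<open>F\<close>.\<close>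
  moreover have "vector_of_values x F = midpoint (?v (- e)) (?v e)"
    by (simp add: vec_eq_iff midpoint_def vector_of_values_def shift_level_def)
  ultimately have "vector_of_values x F \<in> open_segment (?v (- e)) (?v e)"
    by simp
  then show False
    using assms(4) mem[of "- e"] mem[of e] e by (auto simp: extreme_point_of_def)
qed

end
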